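(* Let $\mathcal{A}=(Q,A,\cdot,\circ)$ be an invertible transducer and $G=\mathcal{G}(\mathcal{A})=F_Q/N$. For $k\ge 1$ let $\mathcal{D}_k=(((\partial\mathcal{A})^{-})^{k})_{\mathcal{I}}$ be the input automaton of the $k$-th power of the enriched dual of $\mathcal{A}$. Then: (i) If $v=a_1\ldots a_k\in A^k$ and $H=\mathrm{Stab}_G(v)$, then $(\mathcal{D}_k,v)\simeq(\mathrm{Sch}(H,Q),H)$. (ii) If $\underline v=a_1a_2\ldots\in A^\omega$ and $H=\mathrm{Stab}_G(\underline v)$, then the inverse limit $\mathcal{D}^\infty=\varprojlim\{\mathcal{D}_k\}_{k\ge1}$ is an inverse graph such that $(\mathcal{D}^\infty,\underline v)\simeq(\mathrm{Sch}(H,Q),H)$. (iii) Let $(\mathcal{N}_k,v_k)=\prod_{v\in A^k}(\mathcal{D}_k,v)$. Then $\mathcal{C}(G/\mathrm{Stab}_G(k),Q)\simeq(\mathcal{N}_k,v_k)$. Furthermore, the inclusions $L(\mathcal{N}_k,v_k)\subseteq L(\mathcal{N}_{k-1},v_{k-1})$ induce morphisms $\psi_{k,k-1}:(\mathcal{N}_k,v_k)\to(\mathcal{N}_{k-1},v_{k-1})$ giving rise to an inverse system such that, if $\mathcal{N}^\infty=\varprojlim\{(\mathcal{N}_k,v_k)\}_{k\ge1}$, then $\mathcal{C}(G,Q)\simeq\mathcal{N}^\infty$.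
   Context: A transducer $\mathcal{A}=(Q,A,\cdot,\circ)$ has a finite state set $Q$, a finite alphabet $A$, transition map $q\cdot a\in Q$ and output map $q\circ a\in A$; there is an edge $q\xrightarrow{a|b}p$ iff $q\cdot a=p$, $q\circ a=b$. States act on $A^*$ and on right-infinite words $A^\omega$ by $q\circ(a_1a_2\ldots)=(q\circ a_1)((q\cdot a_1)\circ(a_2\ldots))$. $\mathcal{A}$ is invertible if each $a\mapsto q\circ a$ is a permutation of $A$; then the states generate a group $\mathcal{G}(\mathcal{A})=F_Q/N$ of automorphisms of the rooted tree $A^*$ ($F_Q$ the free group on $Q$), acting also on $A^\omega$. Convention: a word $s_1s_2\cdots s_n$ over $\tilde Q=Q\sqcup Q^{-1}$ ($Q^{-1}$ formal inverses) acts by applying $s_1$ first, then $s_2$, etc. The dual $\partial\mathcal{A}$ has states $A$, alphabet $Q$ and edges $a\xrightarrow{p|q}b$ for each edge $p\xrightarrow{a|b}q$ of $\mathcal{A}$. The enriched dual $(\partial\mathcal{A})^-$ has states $A$, alphabet $\tilde Q$, and is obtained by adding, for each edge $a\xrightarrow{p|q}b$ of $\partial\mathcal{A}$, the edge $b\xrightarrow{p^{-1}|q^{-1}}a$. The product $\mathcal{B}\mathcal{C}$ of transducers over one alphabet has pairs of states as states, with edge $(q,q')\xrightarrow{a|b}(p,p')$ whenever $q\xrightarrow{a|c}p$ in $\mathcal{B}$ and $q'\xrightarrow{c|b}p'$ in $\mathcal{C}$; powers are iterated products, so $((\partial\mathcal{A})^-)^k$ has state set $A^k$. The input automaton $\mathcal{B}_{\mathcal{I}}$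 is the digraph labelled only by the input letters. A $\tilde Q$-labelled digraph is inverse if it is deterministic and has an edge $q\xrightarrow{s^{-1}}p$ for each edge $p\xrightarrow{s}q$. For a labelled digraph $\Gamma$ and a vertex $v$, the automaton $(\Gamma,v)$ means the connected component of $\Gamma$ containing $v$ with base point $v$; $L(\Gamma,v)$ is the set of labels of closed paths at $v$. Morphisms and isomorphisms ($\simeq$) of automata preserve labels and base points. The product of automata $(\Gamma_1,v_1)\times(\Gamma_2,v_2)$ has vertex set the pairs of vertices, an edge $(p,p')\xrightarrow{s}(q,q')$ for each pair of edges $p\xrightarrow{s}q$, $p'\xrightarrow{s}q'$, and base point $(v_1,v_2)$ (again restricted to the component of the base point). The inverse system in (ii) consists of the maps $\mathcal{D}_k\to\mathcal{D}_{k-1}$ given on vertices by deleting the last letter, so the vertex set of $\mathcal{D}^\infty$ is $A^\omega$. In (iii), $\mathcal{N}^\infty$ is the component of the base point $(v_k)_{k\ge1}$ in the inverse limit. For $H\le G$, $\mathrm{Sch}(H,Q)$ is the Schreier graph with vertices the right cosets $Hg$ and edges $Hg\xrightarrow{s}Hgs$ for $s\in\tilde Q$. For a group $K$ generated by the image of $Q$, $\mathcal{C}(K,Q)$ is the Cayley automaton: vertices $K$, edges $g\xrightarrow{s}gs$ for $s\in\tilde Q$, base point the identity. $\mathrm{Stab}_G(k)=\bigcap_{v\in A^k}\mathrm{Stab}_G(v)$. *)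

theory Defs
  imports "HOL-Algebra.Algebra" "HOL-Library.Stream"
begin

section \<open>Transducers and automaton groups\<close>

text \<open>State set and alphabet are the (finite) types \<open>'q\<close> and \<open>'a\<close>.\<close>

record ('q, 'a) transducer =
  transition :: "'q \<Rightarrow> 'a \<Rightarrow> 'q"
  outp :: "'q \<Rightarrow> 'a \<Rightarrow> 'a"

definition invertible :: "('q, 'a) transducer \<Rightarrow> bool" where
  "invertible T \<longleftrightarrow> (\<forall>q. bij (outp T q))"

primrec act :: "('q, 'a) transducer \<Rightarrow> 'q \<Rightarrow> 'a list \<Rightarrow> 'a list" where
  "act T q [] = []"
| "act T q (a # w) = outp T q a # act T (transition T q a) w"

primcorec act_stream :: "('q, 'a) transducer \<Rightarrow> 'q \<Rightarrow> 'a stream \<Rightarrow> 'a stream" where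
  "shd (act_stream T q \<xi>) = outp T q (shd \<xi>)"
| "stl (act_stream T q \<xi>) = act_stream T (transition T q (shd \<xi>)) (stl \<xi>)"

text \<open>Automorphisms of the rooted tree \<open>A\<^sup>*\<close>, in which the children of \<open>w\<close> are the words
  \<open>w @ [a]\<close>. The product \<open>g \<otimes> h\<close> applies \<open>g\<close> first.\<close>

definition tree_aut :: "('a list \<Rightarrow> 'a list) set" where
  "tree_aut = {g. bij g \<and> g [] = [] \<and> (\<forall>w a. \<exists>b. g (w @ [a]) = g w @ [b])}"

definition tree_aut_group :: "('a list \<Rightarrow> 'a list) monoid" where
  "tree_aut_group = \<lparr>carrier = tree_aut, monoid.mult = (\<lambda>g h. h \<circ> g), one = id\<rparr>"

definition automaton_group :: "('q, 'a) transducer \<Rightarrow> ('a list \<Rightarrow> 'a list) monoid" where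
  "automaton_group T = subgroup_generated tree_aut_group (range (act T))"

text \<open>The action of a tree automorphism on the boundary \<open>A\<^sup>\<omega>\<close>; see
  \<open>stake_stream_action\<close> and \<open>stream_action_act\<close> below.\<close>

definition stream_action :: "('a list \<Rightarrow> 'a list) \<Rightarrow> 'a stream \<Rightarrow> 'a stream" where
  "stream_action g \<xi> = (THE \<eta>. \<forall>n. stake n \<eta> = g (stake n \<xi>))"

definition word_stab :: "('q, 'a) transducer \<Rightarrow> 'a list \<Rightarrow> ('a list \<Rightarrow> 'a list) set" where
  "word_stab T v = stabilizer (automaton_group T) (\<lambda>g. g) v"

definition stream_stab :: "('q, 'a) transducer \<Rightarrow> 'a stream \<Rightarrow> ('a list \<Rightarrow> 'a list) set" where
  "stream_stab T \<xi> = stabilizer (automaton_group T) stream_action \<xi>"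

definition level_stab :: "('q, 'a) transducer \<Rightarrow> nat \<Rightarrow> ('a list \<Rightarrow> 'a list) set" where
  "level_stab T k = (\<Inter>v\<in>{v. length v = k}. word_stab T v)"


section \<open>Labelled digraphs and automata\<close>

record ('v, 'l) ldigraph =
  verts :: "'v set"
  edges :: "('v \<times> 'l \<times> 'v) set"

record ('v, 'l) automaton = "('v, 'l) ldigraph" +
  base :: 'v

datatype 'q signed = Pos 'q | Neg 'q

primrec inverse_letter :: "'q signed \<Rightarrow> 'q signed" where
  "inverse_letter (Pos q) = Neg q"
| "inverse_letter (Neg q) = Pos q"

definition inverse_graph :: "('v, 'q signed, 'm) ldigraph_scheme \<Rightarrow> bool" where
  "inverse_graph \<Gamma> \<longleftrightarrow>
     edges \<Gamma> \<subseteq> verts \<Gamma> \<times> UNIV \<times> verts \<Gamma> \<and>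
     (\<forall>p s q q'. (p, s, q) \<in> edges \<Gamma> \<and> (p, s, q') \<in> edges \<Gamma> \<longrightarrow> q = q') \<and>
     (\<forall>p s q. (p, s, q) \<in> edges \<Gamma> \<longrightarrow> (q, inverse_letter s, p) \<in> edges \<Gamma>)"

definition adjacency :: "('v, 'l, 'm) ldigraph_scheme \<Rightarrow> ('v \<times> 'v) set" where
  "adjacency \<Gamma> = {(p, q). \<exists>s. (p, s, q) \<in> edges \<Gamma> \<or> (q, s, p) \<in> edges \<Gamma>}"

definition component :: "('v, 'l, 'm) ldigraph_scheme \<Rightarrow> 'v \<Rightarrow> 'v set" where
  "component \<Gamma> v = {u. (v, u) \<in> (adjacency \<Gamma>)\<^sup>*}"

definition automaton_at :: "('v, 'l, 'm) ldigraph_scheme \<Rightarrow> 'v \<Rightarrow> ('v, 'l) automaton" where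
  "automaton_at \<Gamma> v =
     \<lparr>verts = component \<Gamma> v,
      edges = edges \<Gamma> \<inter> component \<Gamma> v \<times> UNIV \<times> component \<Gamma> v,
      base = v\<rparr>"

primrec path :: "('v, 'l, 'm) ldigraph_scheme \<Rightarrow> 'v \<Rightarrow> 'l list \<Rightarrow> 'v \<Rightarrow> bool" where
  "path \<Gamma> p [] q \<longleftrightarrow> p \<in> verts \<Gamma> \<and> p = q"
| "path \<Gamma> p (s # w) q \<longleftrightarrow> (\<exists>r. (p, s, r) \<in> edges \<Gamma> \<and> path \<Gamma> r w q)"

definition lang :: "('v, 'l, 'm) automaton_scheme \<Rightarrow> 'l list set" where
  "lang \<Gamma> = {w. path \<Gamma> (base \<Gamma>) w (base \<Gamma>)}"

definition graph_morphism ::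
    "('v, 'l, 'm) ldigraph_scheme \<Rightarrow> ('w, 'l, 'n) ldigraph_scheme \<Rightarrow> ('v \<Rightarrow> 'w) \<Rightarrow> bool" where
  "graph_morphism \<Gamma> \<Delta> f \<longleftrightarrow>
     f ` verts \<Gamma> \<subseteq> verts \<Delta> \<and>
     (\<forall>p s q. (p, s, q) \<in> edges \<Gamma> \<longrightarrow> (f p, s, f q) \<in> edges \<Delta>)"

definition automaton_morphism ::
    "('v, 'l, 'm) automaton_scheme \<Rightarrow> ('w, 'l, 'n) automaton_scheme \<Rightarrow> ('v \<Rightarrow> 'w) \<Rightarrow> bool" where
  "automaton_morphism \<Gamma> \<Delta> f \<longleftrightarrow> graph_morphism \<Gamma> \<Delta> f \<and> f (base \<Gamma>) = base \<Delta>"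

definition automaton_iso ::
    "('v, 'l, 'm) automaton_scheme \<Rightarrow> ('w, 'l, 'n) automaton_scheme \<Rightarrow> bool"
    (infix "\<simeq>" 50) where
  "\<Gamma> \<simeq> \<Delta> \<longleftrightarrow> (\<exists>f. bij_betw f (verts \<Gamma>) (verts \<Delta>) \<and> f (base \<Gamma>) = base \<Delta> \<and>
     (\<forall>p\<in>verts \<Gamma>. \<forall>q\<in>verts \<Gamma>. \<forall>s. (p, s, q) \<in> edges \<Gamma> \<longleftrightarrow> (f p, s, f q) \<in> edges \<Delta>))"

text \<open>The product of a family of automata, with families of vertices as vertices.\<close>

definition automaton_product ::
    "'i set \<Rightarrow> ('i \<Rightarrow> ('v, 'l) automaton) \<Rightarrow> ('i \<Rightarrow> 'v, 'l) automaton" where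
  "automaton_product I \<Gamma> = automaton_at
     \<lparr>verts = (\<Pi>\<^sub>E i\<in>I. verts (\<Gamma> i)),
      edges = {(f, s, g). f \<in> (\<Pi>\<^sub>E i\<in>I. verts (\<Gamma> i)) \<and> g \<in> (\<Pi>\<^sub>E i\<in>I. verts (\<Gamma> i)) \<and>
                 (\<forall>i\<in>I. (f i, s, g i) \<in> edges (\<Gamma> i))}\<rparr>
     (\<lambda>i\<in>I. base (\<Gamma> i))"

text \<open>The morphism induced by an inclusion of languages: \<open>x\<close> is sent to the vertex reached from
  the base point of \<open>\<Delta>\<close> by the label of any path from the base point of \<open>\<Gamma>\<close> to \<open>x\<close>.\<close>

definition induced_map ::
    "('v, 'l, 'm) automaton_scheme \<Rightarrow> ('w, 'l, 'n) automaton_scheme \<Rightarrow> 'v \<Rightarrow> 'w" where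
  "induced_map \<Gamma> \<Delta> x = (THE y. \<exists>w. path \<Gamma> (base \<Gamma>) w x \<and> path \<Delta> (base \<Delta>) w y)"

text \<open>Inverse systems are indexed by \<open>k \<ge> 1\<close> and given by their bonding maps \<open>\<psi> k\<close> from
  \<open>\<Gamma> k\<close> to \<open>\<Gamma> (k - 1)\<close>, \<open>k \<ge> 2\<close>.\<close>

definition inverse_system ::
    "(nat \<Rightarrow> ('v, 'l, 'm) ldigraph_scheme) \<Rightarrow> (nat \<Rightarrow> 'v \<Rightarrow> 'v) \<Rightarrow> bool" where
  "inverse_system \<Gamma> \<psi> \<longleftrightarrow> (\<forall>k\<ge>2. graph_morphism (\<Gamma> k) (\<Gamma> (k - 1)) (\<psi> k))"

definition inverse_limit_verts ::
    "(nat \<Rightarrow> ('v, 'l, 'm) ldigraph_scheme) \<Rightarrow> (nat \<Rightarrow> 'v \<Rightarrow> 'v) \<Rightarrow> (nat \<Rightarrow> 'v) set" where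
  "inverse_limit_verts \<Gamma> \<psi> =
     {x \<in> (\<Pi>\<^sub>E k\<in>{1..}. verts (\<Gamma> k)). \<forall>k\<ge>2. \<psi> k (x k) = x (k - 1)}"

definition inverse_limit ::
    "(nat \<Rightarrow> ('v, 'l, 'm) ldigraph_scheme) \<Rightarrow> (nat \<Rightarrow> 'v \<Rightarrow> 'v) \<Rightarrow> (nat \<Rightarrow> 'v, 'l) ldigraph" where
  "inverse_limit \<Gamma> \<psi> =
     \<lparr>verts = inverse_limit_verts \<Gamma> \<psi>,
      edges = {(x, s, y). x \<in> inverse_limit_verts \<Gamma> \<psi> \<and> y \<in> inverse_limit_verts \<Gamma> \<psi> \<and>
                 (\<forall>k\<ge>1. (x k, s, y k) \<in> edges (\<Gamma> k))}\<rparr>"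


section \<open>Schreier graphs and Cayley automata\<close>

definition letter_elem :: "('g, 'm) monoid_scheme \<Rightarrow> ('q \<Rightarrow> 'g) \<Rightarrow> 'q signed \<Rightarrow> 'g" where
  "letter_elem G \<gamma> s = (case s of Pos q \<Rightarrow> \<gamma> q | Neg q \<Rightarrow> inv\<^bsub>G\<^esub> (\<gamma> q))"

definition schreier_graph ::
    "('g, 'm) monoid_scheme \<Rightarrow> ('q \<Rightarrow> 'g) \<Rightarrow> 'g set \<Rightarrow> ('g set, 'q signed) ldigraph" where
  "schreier_graph G \<gamma> H =
     \<lparr>verts = rcosets\<^bsub>G\<^esub> H,
      edges = {(H #>\<^bsub>G\<^esub> g, s, H #>\<^bsub>G\<^esub> (g \<otimes>\<^bsub>G\<^esub> letter_elem G \<gamma> s)) | g s. g \<in> carrier G}\<rparr>"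

definition cayley_automaton ::
    "('g, 'm) monoid_scheme \<Rightarrow> ('q \<Rightarrow> 'g) \<Rightarrow> ('g, 'q signed) automaton" where
  "cayley_automaton K \<gamma> =
     \<lparr>verts = carrier K,
      edges = {(g, s, g \<otimes>\<^bsub>K\<^esub> letter_elem K \<gamma> s) | g s. g \<in> carrier K},
      base = \<one>\<^bsub>K\<^esub>\<rparr>"


section \<open>Powers of the enriched dual\<close>

text \<open>The enriched dual need not be given by functions, so transducers are represented here by
  their graphs: digraphs whose labels are pairs \<open>(input, output)\<close>.\<close>

definition transducer_graph :: "('q, 'a) transducer \<Rightarrow> ('q, 'a \<times> 'a) ldigraph" where
  "transducer_graph T = \<lparr>verts = UNIV, edges = {(q, (a, outp T q a), transition T q a) | q a. True}\<rparr>"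

definition dual :: "('q, 'a) transducer \<Rightarrow> ('a, 'q \<times> 'q) ldigraph" where
  "dual T = \<lparr>verts = UNIV,
     edges = {(a, (p, q), b) | a p q b. (p, (a, b), q) \<in> edges (transducer_graph T)}\<rparr>"

definition enriched_dual :: "('q, 'a) transducer \<Rightarrow> ('a, 'q signed \<times> 'q signed) ldigraph" where
  "enriched_dual T = \<lparr>verts = UNIV,
     edges = {(a, (Pos p, Pos q), b) | a p q b. (a, (p, q), b) \<in> edges (dual T)} \<union>
             {(b, (Neg p, Neg q), a) | a p q b. (a, (p, q), b) \<in> edges (dual T)}\<rparr>"

definition transducer_product ::
    "('v, 'l \<times> 'l) ldigraph \<Rightarrow> ('w, 'l \<times> 'l) ldigraph \<Rightarrow> ('v \<times> 'w, 'l \<times> 'l) ldigraph" where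
  "transducer_product B C =
     \<lparr>verts = verts B \<times> verts C,
      edges = {((q, q'), (a, b), (p, p')) | q q' a b p p'.
                 \<exists>c. (q, (a, c), p) \<in> edges B \<and> (q', (c, b), p') \<in> edges C}\<rparr>"

definition map_verts :: "('v \<Rightarrow> 'w) \<Rightarrow> ('v, 'l) ldigraph \<Rightarrow> ('w, 'l) ldigraph" where
  "map_verts f B = \<lparr>verts = f ` verts B, edges = (\<lambda>(p, s, q). (f p, s, f q)) ` edges B\<rparr>"

text \<open>Iterated products, with nested tuples of states written as lists. The 0th power is the
  one-state identity transducer.\<close>

primrec transducer_power :: "('v, 'l \<times> 'l) ldigraph \<Rightarrow> nat \<Rightarrow> ('v list, 'l \<times> 'l) ldigraph" where
  "transducer_power B 0 = \<lparr>verts = {[]}, edges = {([], (a, a), []) | a. True}\<rparr>"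
| "transducer_power B (Suc k) =
     map_verts (\<lambda>(x, w). x # w) (transducer_product B (transducer_power B k))"

definition input_automaton :: "('v, 'l \<times> 'l) ldigraph \<Rightarrow> ('v, 'l) ldigraph" where
  "input_automaton B =
     \<lparr>verts = verts B, edges = {(p, a, q) | p a q. \<exists>b. (p, (a, b), q) \<in> edges B}\<rparr>"

definition dual_level :: "('q, 'a) transducer \<Rightarrow> nat \<Rightarrow> ('a list, 'q signed) ldigraph" where
  "dual_level T k = input_automaton (transducer_power (enriched_dual T) k)"

definition dual_limit :: "('q, 'a) transducer \<Rightarrow> (nat \<Rightarrow> 'a list, 'q signed) ldigraph" where
  "dual_limit T = inverse_limit (dual_level T) (\<lambda>k. butlast)"

text \<open>The vertex of \<open>dual_limit T\<close> corresponding to an infinite word; see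
  \<open>bij_betw_stream_thread\<close> below.\<close>

definition stream_thread :: "'a stream \<Rightarrow> nat \<Rightarrow> 'a list" where
  "stream_thread \<xi> = (\<lambda>k\<in>{1..}. stake k \<xi>)"

definition level_product ::
    "('q, 'a) transducer \<Rightarrow> nat \<Rightarrow> ('a list \<Rightarrow> 'a list, 'q signed) automaton" where
  "level_product T k =
     automaton_product {v. length v = k} (\<lambda>v. automaton_at (dual_level T k) v)"

definition level_map ::
    "('q, 'a) transducer \<Rightarrow> nat \<Rightarrow> ('a list \<Rightarrow> 'a list) \<Rightarrow> 'a list \<Rightarrow> 'a list" where
  "level_map T k = induced_map (level_product T k) (level_product T (k - 1))"

definition level_limit ::
    "('q, 'a) transducer \<Rightarrow> (nat \<Rightarrow> 'a list \<Rightarrow> 'a list, 'q signed) automaton" where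
  "level_limit T = automaton_at (inverse_limit (level_product T) (level_map T))
                     (\<lambda>k\<in>{1..}. base (level_product T k))"


section \<open>Basic properties\<close>

lemma tree_aut_length: "g \<in> tree_aut \<Longrightarrow> length (g w) = length w"
proof (induction w rule: rev_induct)
  case (snoc a w)
  then obtain b where "g (w @ [a]) = g w @ [b]" unfolding tree_aut_def by blast
  with snoc show ?case by simp
qed (simp add: tree_aut_def)

lemma tree_aut_inv:
  assumes "g \<in> tree_aut"
  shows "inv_into UNIV g \<in> tree_aut"
proof -
  let ?h = "inv_into UNIV g"
  have b: "bij g" and e: "g [] = []" and c: "\<And>w a. \<exists>b. g (w @ [a]) = g w @ [b]"
    using assms unfolding tree_aut_def by auto
  have hg: "?h (g w) = w" and gh: "g (?h w) = w" for w
    using b by (simp_all add: bij_is_inj bij_is_surj surj_f_inv_f)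
  have "\<exists>b. ?h (w @ [a]) = ?h w @ [b]" for w a
  proof (cases "?h (w @ [a])" rule: rev_cases)
    case Nil
    then show ?thesis using gh[of "w @ [a]"] e by simp
  next
    case (snoc u x)
    then obtain y where "w @ [a] = g u @ [y]" using c[of u x] gh[of "w @ [a]"] by auto
    then show ?thesis using snoc hg by auto
  qed
  moreover have "?h [] = []" using hg[of "[]"] e by simp
  ultimately show ?thesis using b by (simp add: tree_aut_def bij_imp_bij_inv)
qed

lemma group_tree_aut_group: "group (tree_aut_group :: ('a list \<Rightarrow> 'a list) monoid)"
proof (rule groupI)
  fix g h :: "'a list \<Rightarrow> 'a list"
  assume "g \<in> carrier tree_aut_group" "h \<in> carrier tree_aut_group"
  then have g: "g \<in> tree_aut" and h: "h \<in> tree_aut" by (simp_all add: tree_aut_group_def)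
  have "\<exists>b. h (g (w @ [a])) = h (g w) @ [b]" for w a
  proof -
    obtain b where "g (w @ [a]) = g w @ [b]" using g unfolding tree_aut_def by blast
    then show ?thesis using h unfolding tree_aut_def by simp
  qed
  with g h show "g \<otimes>\<^bsub>tree_aut_group\<^esub> h \<in> carrier tree_aut_group"
    by (auto simp: tree_aut_group_def tree_aut_def intro: bij_comp)
next
  fix g :: "'a list \<Rightarrow> 'a list"
  assume "g \<in> carrier tree_aut_group"
  then have g: "g \<in> tree_aut" by (simp add: tree_aut_group_def)
  have "inv_into UNIV g \<otimes>\<^bsub>tree_aut_group\<^esub> g = \<one>\<^bsub>tree_aut_group\<^esub>"
    using g by (auto simp: tree_aut_group_def tree_aut_def bij_is_surj surj_f_inv_f)
  with tree_aut_inv[OF g]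
  show "\<exists>h\<in>carrier tree_aut_group. h \<otimes>\<^bsub>tree_aut_group\<^esub> g = \<one>\<^bsub>tree_aut_group\<^esub>"
    by (auto simp: tree_aut_group_def)
qed (auto simp: tree_aut_group_def tree_aut_def comp_assoc)

lemma group_automaton_group: "group (automaton_group T)"
  unfolding automaton_group_def by (rule group.group_subgroup_generated[OF group_tree_aut_group])

lemma act_in_tree_aut:
  assumes "invertible T"
  shows "act T q \<in> tree_aut"
proof -
  have o: "bij (outp T p)" for p using assms by (simp add: invertible_def)
  have "act T q u = act T q v \<Longrightarrow> u = v" for u v
  proof (induction u arbitrary: q v)
    case Nil
    then show ?case by (cases v) auto
  next
    case (Cons a u)
    then show ?case by (cases v) (auto dest: injD[OF bij_is_inj[OF o]])
  qed
  moreover have "\<exists>u. act T q u = v" for v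
  proof (induction v arbitrary: q)
    case Nil
    show ?case by (rule exI[of _ "[]"]) simp
  next
    case (Cons b v)
    obtain a where a: "outp T q a = b" using bij_is_surj[OF o] by (metis surjD)
    obtain u where "act T (transition T q a) u = v" using Cons by blast
    with a show ?case by (intro exI[of _ "a # u"]) simp
  qed
  ultimately have "bij (act T q)" by (metis bijI injI surjI surj_def)
  moreover have "\<exists>b. act T q (w @ [a]) = act T q w @ [b]" for w a
    by (induction w arbitrary: q) auto
  ultimately show ?thesis by (simp add: tree_aut_def)
qed

lemma act_in_automaton_group: "invertible T \<Longrightarrow> act T q \<in> carrier (automaton_group T)"
  unfolding automaton_group_def
  by (auto simp: carrier_subgroup_generated tree_aut_group_def act_in_tree_aut intro: generate.incl)

lemma stream_eqI_stake: "(\<And>n. stake n \<xi> = stake n \<eta>) \<Longrightarrow> \<xi> = \<eta>"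
proof -
  assume e: "\<And>n. stake n \<xi> = stake n \<eta>"
  have "\<xi> !! n = \<eta> !! n" for n using e[of "Suc n"] by (metis lessI stake_nth)
  then have "(!!) \<xi> = (!!) \<eta>" by blast
  then show "\<xi> = \<eta>" by (metis stream_smap_nats)
qed

lemma stream_of_words:
  assumes "\<And>n. length (u n) = n" and "\<And>n. \<exists>b. u (Suc n) = u n @ [b]"
  shows "\<exists>\<eta>. \<forall>n. stake n \<eta> = u n"
proof -
  let ?\<eta> = "smap (\<lambda>n. last (u (Suc n))) nats"
  have "stake n ?\<eta> = u n" for n
  proof (induction n)
    case 0
    then show ?case using assms(1)[of 0] by simp
  next
    case (Suc n)
    obtain b where "u (Suc n) = u n @ [b]" using assms(2) by blast
    then show ?case using Suc by (simp only: stake_Suc) simp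
  qed
  then show ?thesis by blast
qed

lemma stake_stream_action:
  assumes "g \<in> tree_aut"
  shows "stake n (stream_action g \<xi>) = g (stake n \<xi>)"
proof -
  have "\<exists>\<eta>. \<forall>n. stake n \<eta> = g (stake n \<xi>)"
    using assms by (intro stream_of_words) (auto simp: tree_aut_length stake_Suc tree_aut_def
        simp del: stake.simps)
  then have "\<exists>!\<eta>. \<forall>n. stake n \<eta> = g (stake n \<xi>)" by (metis stream_eqI_stake)
  then show ?thesis unfolding stream_action_def using theI'[of "\<lambda>\<eta>. \<forall>n. stake n \<eta> = g (stake n \<xi>)"] by blast
qed

lemma stream_action_act:
  assumes "invertible T"
  shows "stream_action (act T q) \<xi> = act_stream T q \<xi>"
proof (rule stream_eqI_stake)
  fix n
  have "stake n (act_stream T q \<xi>) = act T q (stake n \<xi>)"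
    by (induction n arbitrary: q \<xi>) auto
  then show "stake n (stream_action (act T q) \<xi>) = stake n (act_stream T q \<xi>)"
    using stake_stream_action[OF act_in_tree_aut[OF assms]] by simp
qed

lemma verts_dual_level: "verts (dual_level T k) = {v. length v = k}"
proof (induction k)
  case (Suc k)
  have "verts (dual_level T (Suc k)) = {a # w | a w. w \<in> verts (dual_level T k)}"
    by (auto simp: dual_level_def input_automaton_def map_verts_def transducer_product_def
        enriched_dual_def)
  also have "\<dots> = {v. length v = Suc k}"
    unfolding Suc by (auto simp: length_Suc_conv)
  finally show ?case .
qed (simp add: dual_level_def input_automaton_def)

lemma bij_betw_stream_thread:
  fixes T :: "('q, 'a) transducer"
  shows "bij_betw stream_thread UNIV (verts (dual_limit T))"
proof -
  have "inj (stream_thread :: 'a stream \<Rightarrow> _)"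
  proof (rule injI)
    fix \<xi> \<eta> :: "'a stream"
    assume e: "stream_thread \<xi> = stream_thread \<eta>"
    show "\<xi> = \<eta>"
    proof (rule stream_eqI_stake)
      fix n
      show "stake n \<xi> = stake n \<eta>"
        using fun_cong[OF e, of n] by (cases n) (simp_all add: stream_thread_def del: stake.simps(2))
    qed
  qed
  moreover have "stream_thread \<xi> \<in> verts (dual_limit T)" for \<xi>
  proof -
    have "butlast (stake k \<xi>) = stake (k - 1) \<xi>" if "k \<ge> 2" for k
      using that by (cases k) (simp_all add: stake_Suc del: stake.simps)
    then show ?thesis
      by (auto simp: dual_limit_def inverse_limit_def inverse_limit_verts_def verts_dual_level
          stream_thread_def)
  qed
  moreover have "\<exists>\<xi>. x = stream_thread \<xi>" if "x \<in> verts (dual_limit T)" for x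
  proof -
    have x: "x \<in> (\<Pi>\<^sub>E k\<in>{1..}. {v. length v = k})" "\<And>k. k \<ge> 2 \<Longrightarrow> butlast (x k) = x (k - 1)"
      using that by (auto simp: dual_limit_def inverse_limit_def inverse_limit_verts_def
          verts_dual_level)
    define u where "u n = (if n = 0 then [] else x n)" for n
    have l: "length (u n) = n" for n using x(1) by (auto simp: u_def PiE_iff)
    have "butlast (u (Suc n)) = u n" for n
      using x(2)[of "Suc n"] l[of 0] l[of 1] by (cases n) (auto simp: u_def length_Suc_conv)
    then have "u (Suc n) = u n @ [last (u (Suc n))]" for n
      using l[of "Suc n"] by (metis append_butlast_last_id list.size(3) nat.distinct(1))
    then obtain \<xi> where \<xi>: "\<forall>n. stake n \<xi> = u n" using stream_of_words[of u] l by blast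
    have "x k = stream_thread \<xi> k" for k
      using x(1) \<xi> by (auto simp: stream_thread_def u_def PiE_iff extensional_def)
    then show ?thesis by blast
  qed
  ultimately show ?thesis unfolding bij_betw_def by blast
qed

end

theory Submission
  imports Defs
begin

text \<open>
  The dual exchanges states and letters, so the powers of the enriched dual record the action of
  the group: in \<open>dual_level T k\<close> there is an edge \<open>v \<longrightarrow> w\<close> labelled by the signed letter \<open>s\<close> exactly when
  the group element of \<open>s\<close> maps \<open>v\<close> to \<open>w\<close>, for the output letter of a state \<open>a\<close> of the dual on
  input \<open>p\<close> is the state in which \<open>p\<close> continues after \<open>a\<close>
  (\<open>edges_transducer_power_enriched_dual\<close>). So all automata in question are made of orbits of
  one group \<open>G\<close> acting in different ways.

  Every one of them is then an \<^emph>\<open>orbit automaton\<close>: for some map \<open>f\<close> on \<open>G\<close>, its vertices are the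
  points \<open>f g\<close>, its edges lead from \<open>f g\<close> to \<open>f (g s)\<close>, and its base point is \<open>f 1\<close>. Here \<open>f g\<close> is

  \<^item> the image of the word, or infinite word, under \<open>g\<close> for the components of the dual levels and
    of their limit;
  \<^item> the permutation that \<open>g\<close> induces on the words of length \<open>k\<close> for the product over level \<open>k\<close>,
    and the sequence of these permutations for the limit of the products;
  \<^item> the coset \<open>H g\<close> for the Schreier graph of \<open>H\<close> and for the Cayley automaton of a quotient, and
    \<open>g\<close> itself for the Cayley automaton of \<open>G\<close>.

  Two orbit automata are isomorphic as soon as their maps \<open>f\<close> identify the same pairs of group
  elements (\<open>orbit_automaton_iso\<close>). In all cases \<open>f\<close> is compatible with right multiplication, so
  that it identifies \<open>g\<close> and \<open>h\<close> exactly when they lie in the same right coset of the elements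
  with \<open>f g = f 1\<close> (\<open>traces_coset_eq_iff\<close>); in each case these elements form the
  stabilizer in question. The sequence of the level permutations determines \<open>g\<close>, which gives the
  Cayley automaton of \<open>G\<close> itself.

  Connectedness is what turns a component into an orbit automaton: in an inverse graph that
  contains the edges \<open>f g \<longrightarrow> f (g s)\<close>, determinism leaves no other edge out of a point \<open>f g\<close>, and
  inverse edges leave no other edge into it, while the generators reach all of \<open>G\<close>
  (\<open>automaton_at_traces\<close>). Hence for each graph it suffices to find these edges and to know that
  the graph is inverse, a property that passes to components, products and inverse limits.
\<close>

section \<open>Inverse graphs\<close>

lemma inverse_graph_automaton_at:
  assumes "inverse_graph \<Gamma>"
  shows "inverse_graph (automaton_at \<Gamma> v)"
  using assms unfolding inverse_graph_def automaton_at_def by simp blast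

lemma inverse_graph_pointwise_product:
  assumes "\<And>i. i \<in> I \<Longrightarrow> inverse_graph (\<Gamma> i)"
  shows "inverse_graph
    \<lparr>verts = (\<Pi>\<^sub>E i\<in>I. verts (\<Gamma> i)),
     edges = {(f, s, g). f \<in> (\<Pi>\<^sub>E i\<in>I. verts (\<Gamma> i)) \<and> g \<in> (\<Pi>\<^sub>E i\<in>I. verts (\<Gamma> i)) \<and>
                (\<forall>i\<in>I. (f i, s, g i) \<in> edges (\<Gamma> i))}\<rparr>"
proof -
  have det: "g = g'" if "g \<in> (\<Pi>\<^sub>E i\<in>I. verts (\<Gamma> i))" "g' \<in> (\<Pi>\<^sub>E i\<in>I. verts (\<Gamma> i))"
    "\<forall>i\<in>I. (f i, s, g i) \<in> edges (\<Gamma> i)" "\<forall>i\<in>I. (f i, s, g' i) \<in> edges (\<Gamma> i)" for f s g g'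
  proof (rule PiE_ext[OF that(1,2)])
    fix i assume "i \<in> I"
    then show "g i = g' i" using assms that(3,4) unfolding inverse_graph_def by blast
  qed
  have inv: "(g i, inverse_letter s, f i) \<in> edges (\<Gamma> i)"
    if "i \<in> I" "(f i, s, g i) \<in> edges (\<Gamma> i)" for f s g i
    using assms that unfolding inverse_graph_def by blast
  show ?thesis unfolding inverse_graph_def by (auto intro: det inv)
qed

lemma inverse_graph_inverse_limit:
  assumes "\<And>k. k \<ge> 1 \<Longrightarrow> inverse_graph (\<Gamma> k)"
  shows "inverse_graph (inverse_limit \<Gamma> \<psi>)"
proof -
  let ?V = "inverse_limit_verts \<Gamma> \<psi>"
  have det: "y = y'" if "y \<in> ?V" "y' \<in> ?V" "\<forall>k\<ge>1. (x k, s, y k) \<in> edges (\<Gamma> k)"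
    "\<forall>k\<ge>1. (x k, s, y' k) \<in> edges (\<Gamma> k)" for x s y y'
  proof (rule PiE_ext)
    show "y \<in> (\<Pi>\<^sub>E k\<in>{1..}. verts (\<Gamma> k))" "y' \<in> (\<Pi>\<^sub>E k\<in>{1..}. verts (\<Gamma> k))"
      using that(1,2) by (simp_all add: inverse_limit_verts_def)
  next
    fix k :: nat
    assume "k \<in> {1..}"
    then show "y k = y' k" using assms that(3,4) unfolding inverse_graph_def by simp blast
  qed
  have inv: "(y k, inverse_letter s, x k) \<in> edges (\<Gamma> k)"
    if "k \<ge> 1" "(x k, s, y k) \<in> edges (\<Gamma> k)" for x s y k
    using assms that unfolding inverse_graph_def by blast
  show ?thesis
    unfolding inverse_graph_def inverse_limit_def by (auto intro: det inv simp del: One_nat_def)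
qed

section \<open>Orbit automata\<close>

definition orbit_automaton ::
    "('g, 'm) monoid_scheme \<Rightarrow> ('q \<Rightarrow> 'g) \<Rightarrow> ('g \<Rightarrow> 'v) \<Rightarrow> ('v, 'q signed) automaton" where
  "orbit_automaton G \<gamma> f =
     \<lparr>verts = f ` carrier G,
      edges = {(f g, s, f (g \<otimes>\<^bsub>G\<^esub> letter_elem G \<gamma> s)) | g s. g \<in> carrier G},
      base = f \<one>\<^bsub>G\<^esub>\<rparr>"

locale generated_group = group G for G (structure) +
  fixes \<gamma> :: "'q \<Rightarrow> 'a"
  assumes generator_closed: "\<gamma> q \<in> carrier G"
    and carrier_generate: "carrier G = generate G (range \<gamma>)"
begin

abbreviation letter :: "'q signed \<Rightarrow> 'a" where
  "letter \<equiv> letter_elem G \<gamma>"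

lemma letter_closed [simp]: "letter s \<in> carrier G"
  by (simp add: letter_elem_def generator_closed split: signed.split)

lemma letter_inverse_letter: "letter (inverse_letter s) = inv (letter s)"
  by (cases s) (simp_all add: letter_elem_def generator_closed)

lemma cancel_inverse_letter:
  "g \<in> carrier G \<Longrightarrow> g \<otimes> letter s \<otimes> letter (inverse_letter s) = g"
  by (simp add: letter_inverse_letter m_assoc)

primrec word_elem :: "'q signed list \<Rightarrow> 'a" where
  "word_elem [] = \<one>"
| "word_elem (s # w) = letter s \<otimes> word_elem w"

lemma word_elem_closed [simp]: "word_elem w \<in> carrier G"
  by (induction w) auto

lemma word_elem_append: "word_elem (u @ w) = word_elem u \<otimes> word_elem w"
  by (induction u) (simp_all add: m_assoc)

lemma word_elem_surj:
  assumes "g \<in> carrier G"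
  shows "\<exists>w. g = word_elem w"
proof -
  have "g \<in> generate G (range \<gamma>)" using assms carrier_generate by simp
  then show ?thesis
  proof induction
    case one
    show ?case by (rule exI[of _ "[]"]) simp
  next
    case (incl h)
    then obtain q where "h = \<gamma> q" by blast
    then show ?case
      by (intro exI[of _ "[Pos q]"]) (simp add: letter_elem_def generator_closed)
  next
    case (inv h)
    then obtain q where "h = \<gamma> q" by blast
    then show ?case
      by (intro exI[of _ "[Neg q]"]) (simp add: letter_elem_def generator_closed)
  next
    case (eng g h)
    then show ?case by (metis word_elem_append)
  qed
qed

text \<open>The assignment \<open>f\<close> follows the edges of \<open>\<Gamma>\<close>: multiplying by a letter on the right moves along
  the edge with that label.\<close>

definition traces :: "('v, 'q signed, 'm) ldigraph_scheme \<Rightarrow> ('a \<Rightarrow> 'v) \<Rightarrow> bool" where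
  "traces \<Gamma> f \<longleftrightarrow> inverse_graph \<Gamma> \<and> (\<forall>g\<in>carrier G. \<forall>s. (f g, s, f (g \<otimes> letter s)) \<in> edges \<Gamma>)"

lemma traces_edge_iff:
  assumes "traces \<Gamma> f" "g \<in> carrier G"
  shows "(f g, s, y) \<in> edges \<Gamma> \<longleftrightarrow> y = f (g \<otimes> letter s)"
  using assms unfolding traces_def inverse_graph_def by blast

lemma path_traces:
  assumes "traces \<Gamma> f" "g \<in> carrier G"
  shows "path \<Gamma> (f g) w y \<longleftrightarrow> y = f (g \<otimes> word_elem w)"
  using assms(2)
proof (induction w arbitrary: g)
  case Nil
  \<comment> \<open>As the end of some edge, \<open>f g\<close> is a vertex; any letter will do.\<close>
  have "(f g, undefined, f (g \<otimes> letter undefined)) \<in> edges \<Gamma>"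
    using assms(1) Nil by (simp add: traces_def)
  then have "f g \<in> verts \<Gamma>" using assms(1) unfolding traces_def inverse_graph_def by blast
  then show ?case using Nil by auto
next
  case (Cons s w)
  then show ?case using assms(1) by (simp add: traces_edge_iff m_assoc)
qed

text \<open>A word read from a vertex leads to a unique vertex, so the end point depends on \<open>f g\<close> only.\<close>

lemma traces_congruent:
  assumes "traces \<Gamma> f" "g \<in> carrier G" "h \<in> carrier G" "k \<in> carrier G" "f g = f h"
  shows "f (g \<otimes> k) = f (h \<otimes> k)"
proof -
  obtain w where "k = word_elem w" using word_elem_surj assms(4) by blast
  then show ?thesis using path_traces[OF assms(1)] assms(2,3,5) by metis
qed

text \<open>A walk that starts at \<open>f 1\<close> and ignores the direction of edges stays in the image of \<open>f\<close>, since
  an edge into \<open>f g\<close> is the reverse of an edge out of it, which determinism makes the known one.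
  Conversely, spelling a group element as a word in the letters gives a path to its image.\<close>

lemma component_traces:
  assumes "traces \<Gamma> f"
  shows "component \<Gamma> (f \<one>) = f ` carrier G"
proof
  have "u \<in> f ` carrier G" if "(f \<one>, u) \<in> (adjacency \<Gamma>)\<^sup>*" for u
    using that
  proof induction
    case (step x y)
    then obtain g s where g: "g \<in> carrier G" "x = f g"
      and "(x, s, y) \<in> edges \<Gamma> \<or> (y, s, x) \<in> edges \<Gamma>" by (auto simp: adjacency_def)
    then have "(f g, s, y) \<in> edges \<Gamma> \<or> (f g, inverse_letter s, y) \<in> edges \<Gamma>"
      using assms unfolding traces_def inverse_graph_def by blast
    then show ?case using assms g by (auto simp: traces_edge_iff)
  qed simp
  then show "component \<Gamma> (f \<one>) \<subseteq> f ` carrier G" by (auto simp: component_def)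
  have "(f g, f (g \<otimes> word_elem w)) \<in> (adjacency \<Gamma>)\<^sup>*" if "g \<in> carrier G" for g w
    using that
  proof (induction w arbitrary: g)
    case (Cons s w)
    have "(f g, f (g \<otimes> letter s)) \<in> adjacency \<Gamma>"
      using assms Cons.prems unfolding adjacency_def traces_def by blast
    with Cons.IH[of "g \<otimes> letter s"] Cons.prems show ?case by (simp add: m_assoc)
  qed simp
  from this[of \<one>] show "f ` carrier G \<subseteq> component \<Gamma> (f \<one>)"
    using word_elem_surj by (fastforce simp: component_def)
qed

lemma automaton_at_traces:
  assumes "traces \<Gamma> f"
  shows "automaton_at \<Gamma> (f \<one>) = orbit_automaton G \<gamma> f"
proof -
  have "edges \<Gamma> \<inter> f ` carrier G \<times> UNIV \<times> f ` carrier G =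
      {(f g, s, f (g \<otimes> letter s)) | g s. g \<in> carrier G}"
    using assms by (auto simp: traces_edge_iff)
  then show ?thesis
    by (simp add: automaton_at_def orbit_automaton_def component_traces[OF assms])
qed

text \<open>Lets an orbit automaton serve as a term of an inverse limit.\<close>

lemma traces_orbit_automaton:
  assumes "traces \<Gamma> f"
  shows "traces (orbit_automaton G \<gamma> f) f"
proof -
  have "inverse_graph (orbit_automaton G \<gamma> f)"
    using inverse_graph_automaton_at[of \<Gamma> "f \<one>"] assms
    by (simp add: automaton_at_traces traces_def)
  then show ?thesis by (auto simp: traces_def orbit_automaton_def)
qed

text \<open>An edge between two vertices of either automaton is witnessed by a single group element, and the
  same one witnesses the corresponding edge of the other.\<close>

lemma orbit_automaton_iso:
  assumes "\<And>g h. g \<in> carrier G \<Longrightarrow> h \<in> carrier G \<Longrightarrow> f g = f h \<longleftrightarrow> f' g = f' h"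
  shows "orbit_automaton G \<gamma> f \<simeq> orbit_automaton G \<gamma> f'"
proof -
  define \<phi> where "\<phi> x = f' (inv_into (carrier G) f x)" for x
  have \<phi>: "\<phi> (f g) = f' g" if "g \<in> carrier G" for g
    unfolding \<phi>_def using assms that
    by (metis f_inv_into_f image_eqI inv_into_into)
  have "bij_betw \<phi> (f ` carrier G) (f' ` carrier G)"
    unfolding bij_betw_def inj_on_def using \<phi> assms by (auto simp: image_image)
  moreover have "(f g, s, f h) \<in> edges (orbit_automaton G \<gamma> f) \<longleftrightarrow>
      (f' g, s, f' h) \<in> edges (orbit_automaton G \<gamma> f')"
    if "g \<in> carrier G" "h \<in> carrier G" for g h s
  proof -
    have "f g = f x \<and> f h = f (x \<otimes> letter s) \<longleftrightarrow>
        f' g = f' x \<and> f' h = f' (x \<otimes> letter s)" if "x \<in> carrier G" for x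
      using assms that \<open>g \<in> carrier G\<close> \<open>h \<in> carrier G\<close> by (metis m_closed letter_closed)
    then show ?thesis by (auto simp: orbit_automaton_def)
  qed
  ultimately show ?thesis
    unfolding automaton_iso_def using \<phi>
    by (intro exI[of _ \<phi>]) (simp add: orbit_automaton_def)
qed

section \<open>Schreier graphs and Cayley automata as orbit automata\<close>

text \<open>Determinism is the fact that \<open>H g\<close> and \<open>s\<close> determine \<open>H g s\<close>.\<close>

lemma traces_schreier_graph:
  assumes "subgroup H G"
  shows "traces (schreier_graph G \<gamma> H) (\<lambda>g. H #> g)"
proof -
  have H: "H \<subseteq> carrier G" using assms by (rule subgroup.subset)
  have "H #> (g \<otimes> letter s) = H #> (h \<otimes> letter s)"
    if "g \<in> carrier G" "h \<in> carrier G" "H #> g = H #> h" for g h s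
    using that H by (metis coset_mult_assoc letter_closed)
  then have det: "y = y'" if "(x, s, y) \<in> edges (schreier_graph G \<gamma> H)"
    "(x, s, y') \<in> edges (schreier_graph G \<gamma> H)" for x s y y'
    using that unfolding schreier_graph_def by auto
  have edge: "(H #> g, s, H #> (g \<otimes> letter s)) \<in> edges (schreier_graph G \<gamma> H)"
    if "g \<in> carrier G" for g s
    using that unfolding schreier_graph_def by auto
  have reverse: "(y, inverse_letter s, x) \<in> edges (schreier_graph G \<gamma> H)"
    if xy: "(x, s, y) \<in> edges (schreier_graph G \<gamma> H)" for x s y
  proof -
    obtain g where "g \<in> carrier G" "x = H #> g" "y = H #> (g \<otimes> letter s)"
      using xy unfolding schreier_graph_def by auto
    then show ?thesis
      using edge[of "g \<otimes> letter s" "inverse_letter s"] by (simp add: cancel_inverse_letter)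
  qed
  have "edges (schreier_graph G \<gamma> H) \<subseteq>
      verts (schreier_graph G \<gamma> H) \<times> UNIV \<times> verts (schreier_graph G \<gamma> H)"
    unfolding schreier_graph_def using rcosetsI[OF H] by auto
  then have "inverse_graph (schreier_graph G \<gamma> H)"
    using det reverse unfolding inverse_graph_def by blast
  with edge show ?thesis unfolding traces_def by blast
qed

lemma traces_kernel_subgroup:
  assumes "traces \<Gamma> f"
  shows "subgroup {g \<in> carrier G. f g = f \<one>} G"
proof
  fix g h
  assume gh: "g \<in> {g \<in> carrier G. f g = f \<one>}" "h \<in> {g \<in> carrier G. f g = f \<one>}"
  then have "f (g \<otimes> h) = f (\<one> \<otimes> h)" by (intro traces_congruent[OF assms]) auto
  with gh show "g \<otimes> h \<in> {g \<in> carrier G. f g = f \<one>}" by simp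
next
  fix g
  assume g: "g \<in> {g \<in> carrier G. f g = f \<one>}"
  then have "f (g \<otimes> inv g) = f (\<one> \<otimes> inv g)" by (intro traces_congruent[OF assms]) auto
  with g show "inv g \<in> {g \<in> carrier G. f g = f \<one>}" by simp
qed auto

lemma traces_coset_eq_iff:
  assumes "traces \<Gamma> f" "H = {g \<in> carrier G. f g = f \<one>}" "g \<in> carrier G" "h \<in> carrier G"
  shows "f g = f h \<longleftrightarrow> H #> g = H #> h"
proof -
  have H: "subgroup H G" using traces_kernel_subgroup[OF assms(1)] assms(2) by simp
  have "H #> g = H #> h \<longleftrightarrow> g \<otimes> inv h \<in> H"
    using H assms(3,4) subgroup.subset[OF H]
    by (metis coset_join1 coset_join2 coset_mult_inv1 coset_mult_inv2 inv_closed m_closed)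
  also have "\<dots> \<longleftrightarrow> f (g \<otimes> inv h) = f \<one>" using assms(2-4) by simp
  also have "\<dots> \<longleftrightarrow> f g = f h"
  proof
    assume "f (g \<otimes> inv h) = f \<one>"
    then have "f (g \<otimes> inv h \<otimes> h) = f (\<one> \<otimes> h)"
      using assms(3,4) by (intro traces_congruent[OF assms(1)]) auto
    then show "f g = f h" using assms(3,4) by (simp add: m_assoc)
  next
    assume "f g = f h"
    then have "f (g \<otimes> inv h) = f (h \<otimes> inv h)"
      using assms(3,4) by (intro traces_congruent[OF assms(1)]) auto
    then show "f (g \<otimes> inv h) = f \<one>" using assms(4) by simp
  qed
  finally show ?thesis by simp
qed

text \<open>The orbit-stabilizer correspondence, for labelled graphs.\<close>

lemma automaton_at_iso_schreier:
  assumes "traces \<Gamma> f" "H = {g \<in> carrier G. f g = f \<one>}"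
  shows "automaton_at \<Gamma> (f \<one>) \<simeq> automaton_at (schreier_graph G \<gamma> H) H"
proof -
  have H: "subgroup H G" using traces_kernel_subgroup[OF assms(1)] assms(2) by simp
  have "automaton_at (schreier_graph G \<gamma> H) (H #> \<one>) = orbit_automaton G \<gamma> (\<lambda>g. H #> g)"
    by (rule automaton_at_traces[OF traces_schreier_graph[OF H]])
  moreover have "H #> \<one> = H" by (rule coset_mult_one[OF subgroup.subset[OF H]])
  ultimately show ?thesis
    using orbit_automaton_iso[of f "\<lambda>g. H #> g"] traces_coset_eq_iff[OF assms]
    by (simp add: automaton_at_traces[OF assms(1)])
qed

text \<open>Covers the group itself and its quotients at once.\<close>

lemma cayley_automaton_hom_image:
  assumes "group K" "\<phi> \<in> hom G K" "\<phi> ` carrier G = carrier K"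
  shows "cayley_automaton K (\<lambda>q. \<phi> (\<gamma> q)) = orbit_automaton G \<gamma> \<phi>"
proof -
  interpret \<phi>: group_hom G K \<phi>
    using assms is_group by (simp add: group_hom_def group_hom_axioms_def)
  have "letter_elem K (\<lambda>q. \<phi> (\<gamma> q)) s = \<phi> (letter s)" for s
    by (cases s) (simp_all add: letter_elem_def generator_closed)
  then have "{(x, s, x \<otimes>\<^bsub>K\<^esub> letter_elem K (\<lambda>q. \<phi> (\<gamma> q)) s) | x s. x \<in> \<phi> ` carrier G} =
      {(\<phi> g, s, \<phi> (g \<otimes> letter s)) | g s. g \<in> carrier G}"
    by (force simp: image_iff)
  then show ?thesis
    by (simp add: cayley_automaton_def orbit_automaton_def assms(3))
qed

lemma cayley_automaton_orbit: "cayley_automaton G \<gamma> = orbit_automaton G \<gamma> (\<lambda>g. g)"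
  using cayley_automaton_hom_image[OF is_group, of "\<lambda>g. g"] by (simp add: hom_def)

lemma cayley_quotient_iso:
  assumes "traces \<Gamma> f" "N = {g \<in> carrier G. f g = f \<one>}" "N \<lhd> G"
  shows "cayley_automaton (G Mod N) (\<lambda>q. N #> \<gamma> q) \<simeq> orbit_automaton G \<gamma> f"
proof -
  have "(\<lambda>g. N #> g) ` carrier G = carrier (G Mod N)"
    by (auto simp: FactGroup_def RCOSETS_def)
  then have "cayley_automaton (G Mod N) (\<lambda>q. N #> \<gamma> q) = orbit_automaton G \<gamma> (\<lambda>g. N #> g)"
    by (intro cayley_automaton_hom_image normal.factorgroup_is_group[OF assms(3)]
        normal.r_coset_hom_Mod[OF assms(3)])
  then show ?thesis
    using orbit_automaton_iso[of "\<lambda>g. N #> g" f] traces_coset_eq_iff[OF assms(1,2)] by simp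
qed

lemma lang_traces:
  assumes "traces \<Gamma> f" "base \<Gamma> = f \<one>"
  shows "lang \<Gamma> = {w. f (word_elem w) = f \<one>}"
  using path_traces[OF assms(1), of \<one>] assms(2) by (auto simp: lang_def)

text \<open>A word that leads to \<open>f g\<close> in \<open>\<Gamma>\<close> spells some \<open>h\<close> with \<open>f h = f g\<close>, so that in \<open>\<Delta>\<close> it leads to
  \<open>f' h = f' g\<close>, whichever word is chosen.\<close>

lemma induced_map_traces:
  assumes "traces \<Gamma> f" "base \<Gamma> = f \<one>" "traces \<Delta> f'" "base \<Delta> = f' \<one>"
    and "\<And>g h. g \<in> carrier G \<Longrightarrow> h \<in> carrier G \<Longrightarrow> f g = f h \<Longrightarrow> f' g = f' h"
    and "g \<in> carrier G"
  shows "induced_map \<Gamma> \<Delta> (f g) = f' g"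
proof -
  obtain w where w: "g = word_elem w" using word_elem_surj assms(6) by blast
  show ?thesis
    unfolding induced_map_def assms(2,4)
  proof (rule the_equality)
    show "\<exists>u. path \<Gamma> (f \<one>) u (f g) \<and> path \<Delta> (f' \<one>) u (f' g)"
      using w by (intro exI[of _ w]) (simp add: path_traces[OF assms(1)] path_traces[OF assms(3)])
  next
    fix y
    assume "\<exists>u. path \<Gamma> (f \<one>) u (f g) \<and> path \<Delta> (f' \<one>) u y"
    then obtain u where "f g = f (word_elem u)" "y = f' (word_elem u)"
      by (auto simp: path_traces[OF assms(1)] path_traces[OF assms(3)])
    then show "y = f' g" using assms(5)[OF assms(6) word_elem_closed] by simp
  qed
qed

lemma orbit_automaton_morphism:
  assumes "\<And>g. g \<in> carrier G \<Longrightarrow> \<psi> (f g) = f' g"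
  shows "automaton_morphism (orbit_automaton G \<gamma> f) (orbit_automaton G \<gamma> f') \<psi>"
  using assms
  by (auto simp: automaton_morphism_def graph_morphism_def orbit_automaton_def)

end

section \<open>The dual levels as orbit graphs\<close>

text \<open>Feeding a state \<open>p\<close> to the product of the dual states in \<open>v\<close> runs \<open>T\<close> from \<open>p\<close> on \<open>v\<close>: the
  letters of \<open>v\<close> are replaced one by one, and the state reached after each of them is handed on to
  the next factor. Inverse letters run the same computation backwards.\<close>

lemma edges_transducer_power_enriched_dual:
  fixes T :: "('q, 'a) transducer"
  shows "edges (transducer_power (enriched_dual T) k) =
     {(v, (Pos p, Pos (foldl (transition T) p v)), act T p v) | p v. length v = k} \<union>
     {(act T p v, (Neg p, Neg (foldl (transition T) p v)), v) | p v. length v = k}"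
proof (induction k)
  case 0
  have "(\<exists>p. a = Pos p) \<or> (\<exists>p. a = Neg p)" for a :: "'q signed"
    by (cases a) simp_all
  then have "{([], (a, a), []) | a :: 'q signed. True} =
      {([] :: 'a list, (Pos p, Pos p), [] :: 'a list) | p. True} \<union>
      {([], (Neg p, Neg p), []) | p. True}" by blast
  then show ?case by simp
next
  case (Suc k)
  have enr: "edges (enriched_dual T) =
      {(a, (Pos p, Pos (transition T p a)), outp T p a) | p a. True} \<union>
      {(outp T p a, (Neg p, Neg (transition T p a)), a) | p a. True}"
    by (auto simp: enriched_dual_def dual_def transducer_graph_def)
  have step: "(v, l, w) \<in> edges (transducer_power (enriched_dual T) (Suc k)) \<longleftrightarrow>
      (\<exists>a u x y z b u'. v = a # u \<and> l = (x, z) \<and> w = b # u' \<and>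
        (a, (x, y), b) \<in> edges (enriched_dual T) \<and>
        (u, (y, z), u') \<in> edges (transducer_power (enriched_dual T) k))" for v l w
    by (simp add: map_verts_def transducer_product_def image_iff) blast
  have "(v, l, w) \<in> edges (transducer_power (enriched_dual T) (Suc k)) \<longleftrightarrow>
     (\<exists>p a u. length u = k \<and> v = a # u \<and> w = act T p (a # u) \<and>
        l = (Pos p, Pos (foldl (transition T) p (a # u)))) \<or>
     (\<exists>p a u. length u = k \<and> w = a # u \<and> v = act T p (a # u) \<and>
        l = (Neg p, Neg (foldl (transition T) p (a # u))))" for v l w
    unfolding step Suc enr by simp blast
  then show ?case by (fastforce simp: length_Suc_conv)
qed

lemma edges_dual_level:
  "edges (dual_level T k) = {(v, Pos p, act T p v) | p v. length v = k} \<union>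
     {(act T p v, Neg p, v) | p v. length v = k}"
  by (auto simp: dual_level_def input_automaton_def edges_transducer_power_enriched_dual)

lemma length_act [simp]: "length (act T q v) = length v"
  by (induction v arbitrary: q) auto

text \<open>Invertibility gives determinism at the inverse letters, since each state acts injectively.\<close>

lemma inverse_graph_dual_level:
  assumes "invertible T"
  shows "inverse_graph (dual_level T k)"
proof -
  have "inj (act T q)" for q using act_in_tree_aut[OF assms] by (simp add: tree_aut_def bij_is_inj)
  then show ?thesis
    by (auto simp: inverse_graph_def edges_dual_level verts_dual_level dest: injD)
qed

lemma tree_aut_butlast:
  assumes "g \<in> tree_aut"
  shows "butlast (g v) = g (butlast v)"
proof (cases v rule: rev_cases)
  case (snoc u a)
  obtain b where "g (u @ [a]) = g u @ [b]" using assms unfolding tree_aut_def by blast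
  then show ?thesis using snoc by simp
qed (use assms in \<open>simp add: tree_aut_def\<close>)

lemma inverse_system_dual_level:
  assumes "invertible T"
  shows "inverse_system (dual_level T) (\<lambda>k. butlast)"
  using tree_aut_butlast[OF act_in_tree_aut[OF assms]]
  by (fastforce simp: inverse_system_def graph_morphism_def edges_dual_level verts_dual_level)

locale invertible_transducer =
  fixes T :: "('q, 'a) transducer"
  assumes invertible: "invertible T"
begin

abbreviation "G \<equiv> automaton_group T"

lemma carrier_automaton_group: "carrier G = generate tree_aut_group (range (act T))"
proof -
  have "carrier tree_aut_group \<inter> range (act T) = range (act T)"
    using act_in_tree_aut[OF invertible] by (auto simp: tree_aut_group_def)
  then show ?thesis by (simp add: automaton_group_def carrier_subgroup_generated)
qed

lemma automaton_group_tree_aut: "g \<in> carrier G \<Longrightarrow> g \<in> tree_aut"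
  using group.carrier_subgroup_generated_subset[OF group_tree_aut_group, of "range (act T)"]
  by (auto simp: automaton_group_def tree_aut_group_def)

lemma automaton_group_mult [simp]: "(g \<otimes>\<^bsub>G\<^esub> h) v = h (g v)"
  by (simp add: automaton_group_def tree_aut_group_def)

lemma automaton_group_one [simp]: "\<one>\<^bsub>G\<^esub> v = v"
  by (simp add: automaton_group_def tree_aut_group_def)

text \<open>The carrier is by definition generated inside the group of all tree automorphisms; the products
  and inverses that occur there are those of the subgroup.\<close>

lemma generated_automaton_group: "generated_group G (act T)"
proof -
  interpret group G by (rule group_automaton_group)
  have "g \<in> generate G (range (act T))" if "g \<in> generate tree_aut_group (range (act T))" for g
    using that
  proof induction
    case one
    have "\<one>\<^bsub>tree_aut_group\<^esub> = \<one>\<^bsub>G\<^esub>" by (simp add: automaton_group_def)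
    then show ?case by (simp only: generate.one)
  next
    case (incl h)
    then show ?case by (rule generate.incl)
  next
    case (inv h)
    then have "h \<in> carrier G" using act_in_automaton_group[OF invertible] by blast
    then have "inv\<^bsub>tree_aut_group\<^esub> h = inv\<^bsub>G\<^esub> h"
      unfolding automaton_group_def
      by (simp add: group.inv_subgroup_generated[OF group_tree_aut_group])
    with inv show ?case by (simp only: generate.inv)
  next
    case (eng g h)
    have "g \<otimes>\<^bsub>tree_aut_group\<^esub> h = g \<otimes>\<^bsub>G\<^esub> h" by (simp add: automaton_group_def)
    with eng show ?case by (simp only: generate.eng)
  qed
  moreover have "generate G (range (act T)) \<subseteq> carrier G"
    using act_in_automaton_group[OF invertible] by (intro generate_incl) auto
  ultimately show ?thesis
    using carrier_automaton_group act_in_automaton_group[OF invertible] by unfold_locales auto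
qed

sublocale generated_group G "act T" by (rule generated_automaton_group)

lemma act_inv_apply:
  "act T q ((inv\<^bsub>G\<^esub> (act T q)) v) = v"
  using fun_cong[OF l_inv[OF generator_closed[of q]], of v] by simp

lemma dual_level_edge:
  assumes "length v = k"
  shows "(v, s, letter s v) \<in> edges (dual_level T k)"
proof (cases s)
  case (Pos q)
  then show ?thesis using assms by (auto simp: edges_dual_level letter_elem_def)
next
  case (Neg q)
  let ?u = "(inv\<^bsub>G\<^esub> (act T q)) v"
  have u: "act T q ?u = v" by (rule act_inv_apply)
  then have "length ?u = k" using assms by (metis length_act)
  with u have "(v, Neg q, ?u) \<in> edges (dual_level T k)"
    unfolding edges_dual_level by (metis (mono_tags, lifting) UnI2 mem_Collect_eq)
  with Neg show ?thesis by (simp add: letter_elem_def)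
qed

lemma traces_dual_level:
  assumes "length v = k"
  shows "traces (dual_level T k) (\<lambda>g. g v)"
  using dual_level_edge inverse_graph_dual_level[OF invertible] assms
  by (simp add: traces_def tree_aut_length[OF automaton_group_tree_aut])

lemma word_stab_kernel: "word_stab T v = {g \<in> carrier G. g v = \<one>\<^bsub>G\<^esub> v}"
  by (simp add: word_stab_def stabilizer_def)

lemma dual_level_iso_schreier:
  assumes "length v = k"
  shows "automaton_at (dual_level T k) v \<simeq>
    automaton_at (schreier_graph G (act T) (word_stab T v)) (word_stab T v)"
  using automaton_at_iso_schreier[OF traces_dual_level[OF assms] word_stab_kernel] by simp

section \<open>The limit of the dual levels\<close>

lemma inverse_graph_dual_limit: "inverse_graph (dual_limit T)"
  unfolding dual_limit_def by (intro inverse_graph_inverse_limit inverse_graph_dual_level[OF invertible])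

lemma stream_thread_action:
  "g \<in> carrier G \<Longrightarrow> k \<ge> 1 \<Longrightarrow> stream_thread (stream_action g \<xi>) k = g (stake k \<xi>)"
  by (simp add: stream_thread_def stake_stream_action automaton_group_tree_aut)

lemma stream_thread_verts:
  "stream_thread \<xi> \<in> inverse_limit_verts (dual_level T) (\<lambda>k. butlast)"
  using bij_betw_apply[OF bij_betw_stream_thread, of \<xi> T]
  by (simp add: dual_limit_def inverse_limit_def)

lemma traces_dual_limit:
  "traces (dual_limit T) (\<lambda>g. stream_thread (stream_action g \<xi>))"
  unfolding traces_def
proof (intro conjI ballI allI)
  fix g s
  assume g: "g \<in> carrier G"
  have "(stream_thread (stream_action g \<xi>) k, s,
      stream_thread (stream_action (g \<otimes>\<^bsub>G\<^esub> letter s) \<xi>) k) \<in> edges (dual_level T k)"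
    if "k \<ge> 1" for k
    using dual_level_edge that g
    by (simp add: stream_thread_action tree_aut_length[OF automaton_group_tree_aut])
  then show "(stream_thread (stream_action g \<xi>), s,
      stream_thread (stream_action (g \<otimes>\<^bsub>G\<^esub> letter s) \<xi>)) \<in> edges (dual_limit T)"
    using stream_thread_verts by (simp add: dual_limit_def inverse_limit_def)
qed (rule inverse_graph_dual_limit)

lemma stream_action_one: "stream_action \<one>\<^bsub>G\<^esub> \<xi> = \<xi>"
  by (rule stream_eqI_stake)
    (simp add: stake_stream_action automaton_group_tree_aut)

lemma dual_limit_iso_schreier:
  "automaton_at (dual_limit T) (stream_thread \<xi>) \<simeq>
    automaton_at (schreier_graph G (act T) (stream_stab T \<xi>)) (stream_stab T \<xi>)"
proof -
  have inj: "inj (stream_thread :: 'a stream \<Rightarrow> _)"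
    using bij_betw_stream_thread by (rule bij_betw_imp_inj_on)
  have "stream_stab T \<xi> = {g \<in> carrier G. stream_thread (stream_action g \<xi>) =
      stream_thread (stream_action \<one>\<^bsub>G\<^esub> \<xi>)}"
    by (simp add: stream_stab_def stabilizer_def stream_action_one inj_eq[OF inj])
  from automaton_at_iso_schreier[OF traces_dual_limit this] show ?thesis
    by (simp add: stream_action_one)
qed

section \<open>Level products and their limit\<close>

abbreviation level_perm :: "nat \<Rightarrow> ('a list \<Rightarrow> 'a list) \<Rightarrow> 'a list \<Rightarrow> 'a list" where
  "level_perm k g \<equiv> (\<lambda>v\<in>{v. length v = k}. g v)"

lemma level_perm_eq_iff:
  "level_perm k g = level_perm k h \<longleftrightarrow> (\<forall>v. length v = k \<longrightarrow> g v = h v)"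
  by (auto simp: fun_eq_iff restrict_def)

text \<open>Each factor is the orbit automaton of one word \<open>v\<close>, so the tuple of all images \<open>g v\<close> moves along
  the edges of the product. The passage to the component of the base point keeps exactly the tuples
  coming from one group element.\<close>

lemma level_product_orbit:
  "level_product T k = orbit_automaton G (act T) (level_perm k)"
  "traces (level_product T k) (level_perm k)"
proof -
  let ?I = "{v :: 'a list. length v = k}"
  let ?\<Gamma> = "\<lambda>v. automaton_at (dual_level T k) v"
  let ?P = "\<lparr>verts = (\<Pi>\<^sub>E v\<in>?I. verts (?\<Gamma> v)),
     edges = {(f, s, g). f \<in> (\<Pi>\<^sub>E v\<in>?I. verts (?\<Gamma> v)) \<and> g \<in> (\<Pi>\<^sub>E v\<in>?I. verts (?\<Gamma> v)) \<and>
                (\<forall>v\<in>?I. (f v, s, g v) \<in> edges (?\<Gamma> v))}\<rparr> :: ('a list \<Rightarrow> 'a list, 'q signed) ldigraph"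
  have \<Gamma>: "?\<Gamma> v = orbit_automaton G (act T) (\<lambda>g. g v)" if "length v = k" for v
    using automaton_at_traces[OF traces_dual_level[OF that]] by simp
  have "inverse_graph ?P"
    by (intro inverse_graph_pointwise_product inverse_graph_automaton_at
        inverse_graph_dual_level[OF invertible])
  moreover have "(level_perm k g, s, level_perm k (g \<otimes>\<^bsub>G\<^esub> letter s)) \<in> edges ?P"
    if "g \<in> carrier G" for g s
  proof -
    have "(g v, s, (g \<otimes>\<^bsub>G\<^esub> letter s) v) \<in> edges (?\<Gamma> v)" "g v \<in> verts (?\<Gamma> v)"
      "(g \<otimes>\<^bsub>G\<^esub> letter s) v \<in> verts (?\<Gamma> v)" if "length v = k" for v
      unfolding \<Gamma>[OF that] using \<open>g \<in> carrier G\<close> m_closed[OF \<open>g \<in> carrier G\<close> letter_closed[of s]]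
      by (auto simp: orbit_automaton_def simp del: automaton_group_mult)
    then show ?thesis by (simp del: automaton_group_mult)
  qed
  ultimately have tr: "traces ?P (level_perm k)" unfolding traces_def by blast
  have "level_perm k \<one>\<^bsub>G\<^esub> = (\<lambda>v\<in>?I. base (?\<Gamma> v))"
    by (intro restrict_ext) (simp add: automaton_at_def)
  then show eq: "level_product T k = orbit_automaton G (act T) (level_perm k)"
    using automaton_at_traces[OF tr] by (simp add: level_product_def automaton_product_def)
  show "traces (level_product T k) (level_perm k)"
    unfolding eq by (rule traces_orbit_automaton[OF tr])
qed

lemma base_level_product: "base (level_product T k) = level_perm k \<one>\<^bsub>G\<^esub>"
  by (simp add: level_product_orbit(1) orbit_automaton_def del: automaton_group_one)

lemma exists_word_of_length: "\<exists>v :: 'a list. length v = k"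
  by (rule exI[of _ "replicate k undefined"]) simp

lemma level_stab_kernel:
  "level_stab T k = {g \<in> carrier G. level_perm k g = level_perm k \<one>\<^bsub>G\<^esub>}"
  unfolding level_stab_def level_perm_eq_iff word_stab_kernel
  using exists_word_of_length[of k] by auto

text \<open>Tree automorphisms preserve length, so conjugation permutes the stabilizers of the words of one
  level.\<close>

lemma level_stab_normal: "level_stab T k \<lhd> G"
proof (rule normal_invI)
  show "subgroup (level_stab T k) G"
    unfolding level_stab_kernel by (rule traces_kernel_subgroup[OF level_product_orbit(2)])
next
  fix h g
  assume h: "h \<in> level_stab T k" and g: "g \<in> carrier G"
  have h': "h \<in> carrier G" "\<And>v. length v = k \<Longrightarrow> h v = v"
    using h by (auto simp: level_stab_kernel level_perm_eq_iff)
  have "(inv\<^bsub>G\<^esub> g) (h (g v)) = v" if "length v = k" for v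
    using h'(2)[of "g v"] that fun_cong[OF r_inv[OF g], of v]
      tree_aut_length[OF automaton_group_tree_aut[OF g]] by simp
  then show "g \<otimes>\<^bsub>G\<^esub> h \<otimes>\<^bsub>G\<^esub> inv\<^bsub>G\<^esub> g \<in> level_stab T k"
    using h'(1) g by (auto simp: level_stab_kernel level_perm_eq_iff)
qed

lemma cayley_level_iso:
  "cayley_automaton (G Mod level_stab T k) (\<lambda>q. level_stab T k #>\<^bsub>G\<^esub> act T q) \<simeq> level_product T k"
  unfolding level_product_orbit(1)
  by (rule cayley_quotient_iso[OF level_product_orbit(2) level_stab_kernel level_stab_normal])

text \<open>The image of \<open>v\<close> is a prefix of the image of any extension of \<open>v\<close> by a letter.\<close>

lemma level_perm_pred:
  assumes "g \<in> carrier G" "h \<in> carrier G" "level_perm k g = level_perm k h" "k \<ge> 1"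
  shows "level_perm (k - 1) g = level_perm (k - 1) h"
  unfolding level_perm_eq_iff
proof (intro allI impI)
  fix v :: "'a list"
  assume "length v = k - 1"
  then have "g (v @ [undefined]) = h (v @ [undefined])"
    using assms(3,4) by (simp add: level_perm_eq_iff)
  then show "g v = h v"
    using assms(1,2) tree_aut_butlast[OF automaton_group_tree_aut] by (metis butlast_snoc)
qed

lemma level_map_level_perm:
  assumes "k \<ge> 1" "g \<in> carrier G"
  shows "level_map T k (level_perm k g) = level_perm (k - 1) g"
  unfolding level_map_def
proof (rule induced_map_traces[OF level_product_orbit(2) base_level_product
      level_product_orbit(2) base_level_product])
  show "level_perm (k - 1) g = level_perm (k - 1) h"
    if "g \<in> carrier G" "h \<in> carrier G" "level_perm k g = level_perm k h" for g h
    using that assms(1) by (rule level_perm_pred)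
qed (rule assms(2))

lemma lang_level_product_mono:
  assumes "k \<ge> 1"
  shows "lang (level_product T k) \<subseteq> lang (level_product T (k - 1))"
proof -
  have lang: "lang (level_product T j) =
      {w. level_perm j (word_elem w) = level_perm j \<one>\<^bsub>G\<^esub>}" for j
    by (rule lang_traces[OF level_product_orbit(2) base_level_product])
  show ?thesis
    unfolding lang using level_perm_pred[OF word_elem_closed one_closed _ assms] by blast
qed

lemma level_map_morphism:
  assumes "k \<ge> 1"
  shows "automaton_morphism (level_product T k) (level_product T (k - 1)) (level_map T k)"
  unfolding level_product_orbit(1)
  by (intro orbit_automaton_morphism level_map_level_perm assms)

lemma inverse_system_level_product: "inverse_system (level_product T) (level_map T)"
  using level_map_morphism by (auto simp: inverse_system_def automaton_morphism_def)

text \<open>By \<open>level_map_level_perm\<close>, the permutations induced by one group element on all levels form a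
  thread of the inverse system.\<close>

lemma traces_level_limit:
  "traces (inverse_limit (level_product T) (level_map T)) (\<lambda>g. \<lambda>k\<in>{1..}. level_perm k g)"
  unfolding traces_def
proof (intro conjI ballI allI)
  show "inverse_graph (inverse_limit (level_product T) (level_map T))"
    using level_product_orbit(2) by (intro inverse_graph_inverse_limit) (simp add: traces_def)
next
  fix g s
  assume g: "g \<in> carrier G"
  have "(\<lambda>k\<in>{1..}. level_perm k h) \<in> inverse_limit_verts (level_product T) (level_map T)"
    if "h \<in> carrier G" for h
    using that level_map_level_perm[of _ h]
    by (auto simp: inverse_limit_verts_def level_product_orbit(1) orbit_automaton_def)
  from this[OF g] this[OF m_closed[OF g letter_closed[of s]]]
  show "(\<lambda>k\<in>{1..}. level_perm k g, s, \<lambda>k\<in>{1..}. level_perm k (g \<otimes>\<^bsub>G\<^esub> letter s))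
      \<in> edges (inverse_limit (level_product T) (level_map T))"
    using level_product_orbit(2) g
    by (auto simp: inverse_limit_def traces_def simp del: automaton_group_mult)
qed

text \<open>The levels from 1 on determine a tree automorphism, as the empty word is always fixed.\<close>

lemma level_perms_eq_iff:
  assumes "g \<in> carrier G" "h \<in> carrier G"
  shows "g = h \<longleftrightarrow> (\<lambda>k\<in>{1..}. level_perm k g) = (\<lambda>k\<in>{1..}. level_perm k h)"
proof
  assume eq: "(\<lambda>k\<in>{1..}. level_perm k g) = (\<lambda>k\<in>{1..}. level_perm k h)"
  show "g = h"
  proof
    fix v
    show "g v = h v"
    proof (cases "v = []")
      case True
      then show ?thesis using assms[THEN automaton_group_tree_aut] by (simp add: tree_aut_def)
    next
      case False
      then have "length v \<in> {1..}" by (cases v) auto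
      then have "level_perm (length v) g = level_perm (length v) h"
        using fun_cong[OF eq, of "length v"] by simp
      then show ?thesis by (simp add: level_perm_eq_iff)
    qed
  qed
qed simp

lemma cayley_level_limit_iso: "cayley_automaton G (act T) \<simeq> level_limit T"
proof -
  have "level_limit T = orbit_automaton G (act T) (\<lambda>g. \<lambda>k\<in>{1..}. level_perm k g)"
    unfolding level_limit_def base_level_product by (rule automaton_at_traces[OF traces_level_limit])
  then show ?thesis
    unfolding cayley_automaton_orbit by (simp only:) (rule orbit_automaton_iso[OF level_perms_eq_iff])
qed

end

theorem theorem3:
  fixes T :: "('q::finite, 'a::finite) transducer"
  assumes "invertible T"
  shows
    "(\<forall>k\<ge>1. \<forall>v. length v = k \<longrightarrow>
        automaton_at (dual_level T k) v \<simeq>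
        automaton_at (schreier_graph (automaton_group T) (act T) (word_stab T v)) (word_stab T v))
   \<and>
     (inverse_system (dual_level T) (\<lambda>k. butlast) \<and>
      inverse_graph (dual_limit T) \<and>
      (\<forall>\<xi>. automaton_at (dual_limit T) (stream_thread \<xi>) \<simeq>
           automaton_at (schreier_graph (automaton_group T) (act T) (stream_stab T \<xi>))
             (stream_stab T \<xi>)))
   \<and>
     ((\<forall>k\<ge>1. cayley_automaton (automaton_group T Mod level_stab T k)
                 (\<lambda>q. level_stab T k #>\<^bsub>automaton_group T\<^esub> act T q) \<simeq> level_product T k) \<and>
      (\<forall>k\<ge>2. lang (level_product T k) \<subseteq> lang (level_product T (k - 1)) \<and>
              automaton_morphism (level_product T k) (level_product T (k - 1)) (level_map T k)) \<and>
      inverse_system (level_product T) (level_map T) \<and>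
      cayley_automaton (automaton_group T) (act T) \<simeq> level_limit T)"
proof -
  interpret invertible_transducer T by unfold_locales (rule assms)
  show ?thesis
    by (intro conjI allI impI dual_level_iso_schreier inverse_system_dual_level
        inverse_graph_dual_limit dual_limit_iso_schreier cayley_level_iso
        lang_level_product_mono level_map_morphism inverse_system_level_product
        cayley_level_limit_iso assms) simp_all
qed

end
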